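(* Let $P$ be an EC$^{DE}$ program (Event Calculus with delayed effects), let $S$ be a stream, and let $P'$ be the program obtained from $P$ by the translation $\mathsf{EC2TD}$ described in the context. Then $P'$ is a Temporal Datalog$^{\rightarrow}_{\circleddash}$ program. Moreover, for each (ground) fluent $f(\boldsymbol X)$, each value $v$ of $f$ and each time-point $t$, $P\cup S$ derives $\mathsf{holdsAt}(f(\boldsymbol X)=v,t)$ iff $I^*\models f^h(\boldsymbol X,v,t)$, where $I^*$ is the perfect model of $P'\cup S$ (with each fact $\mathsf{happensAt}(e(\boldsymbol x),s)$ of $S$ read as $e(\boldsymbol x,s)$).
   Context: **Time.** Time-points are positive integers; constants are split into objects and time-points. Atoms with non-positive time are false. A stream $S$ is an (unbounded) set of facts $\mathsf{happensAt}(e(\boldsymbol x),s)$. **EC$^{DE}$ programs.** There are event types $e$ and fluent types $f$ (functors applied to tuples of objects and object variables), and each fluent type has a set of possible values (constants). Each fluent type is either *simple* or *statically determined*. An EC$^{DE}$ program $P$ consists of the following. (a) For simple fluents, rules with head $\mathsf{initiatedAt}(f(\boldsymbol{X_f})=v,T)$ or $\mathsf{terminatedAt}(f(\boldsymbol{X_f})=v,T)$ whose body contains a positive condition $\mathsf{happensAt}(e_1(\boldsymbol{X_{e_1}}),T)$ and optionally further, possibly negated (by $\mathsf{not}$), conditions $\mathsf{happensAt}(e_i(\boldsymbol{X_{e_i}}),T)$ and $\mathsf{holdsAt}(f_j(\boldsymbol{X_{f_j}})=v_j,T)$. (b) For statically determined fluents, rules with head $\mathsf{holdsAt}(f(\boldsymbol{X_f})=v,T)$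 whose body consists of at least one, possibly negated, condition of the form $\mathsf{holdsAt}(f_{j}(\boldsymbol{X_{f_j}})=v_{j},T)$. There are no cyclic dependencies among fluents via statically determined definitions. (c) Possibly facts $\mathsf{fi}(f(\boldsymbol X)=v,f(\boldsymbol X)=v',d)$ ($d$ a positive integer) and $\mathsf{p}(f(\boldsymbol X)=v)$, for simple $f$, with $\boldsymbol X$ implicitly universally quantified. (d) The domain-independent rules (with $F$ ranging over simple fluents, $V,V'$ over values of $F$): - $\mathsf{initiatedAt}(F=V',T+d)\leftarrow \mathsf{fi}(F=V,F=V',d),\ \mathsf{initiatedAt}(F=V,T),\ \mathsf{not}\ \mathsf{cancelled}(F=V,T,T+d)$; - $\mathsf{cancelled}(F=V,T,T+d)\leftarrow \mathsf{termIn}(F=V,T,T+d)$; - $\mathsf{cancelled}(F=V,T,T+d)\leftarrow \mathsf{p}(F=V),\ \mathsf{initIn}(F=V,T,T+d)$; - $\mathsf{holdsAt}(F=V,T)\leftarrow\mathsf{initiatedAt}(F=V,T-1)$; - $\mathsf{holdsAt}(F=V,T)\leftarrow\mathsf{holdsAt}(F=V,T-1),\ \mathsf{not}\ \mathsf{terminatedAt}(F=V,T-1)$; - $\mathsf{terminatedAt}(F=V,T)\leftarrow\mathsf{initiatedAt}(F=V',T),\ V'\ne V$. Here $\mathsf{initIn}(F=V,T,T+d)$ (resp. $\mathsf{termIn}(F=V,T,T+d)$) states that $F=V$ is initiated (resp. terminated) at some time-point strictly between $T$ and $T+d$. EC$^{DE}$ programs are locally stratified, and "$P\cup S$ derives"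 refers to the unique perfect model of $P\cup S$. **Temporal Datalog$^{\rightarrow}_{\circleddash}$.** Rules are function-free and have the form $$h(\boldsymbol{X_h},T)\leftarrow b_1(\boldsymbol{X_{b_1}},T-k_{b_1}),\dots,b_m(\boldsymbol{X_{b_m}},T-k_{b_m}),\ \mathsf{not}\ c_1(\boldsymbol{X_{c_1}},T-k_{c_1}),\dots,\mathsf{not}\ c_k(\boldsymbol{X_{c_k}},T-k_{c_k}),$$ with one time variable $T$, object-term tuples and integer offsets. A program is *forward-propagating* if all offsets are non-negative. A program is *locally stratified* if its ground atoms can be partitioned into a (possibly infinite) sequence of strata $B_1,B_2,\dots$ so that in each ground rule instance with head in $B_i$, atoms of positive conditions lie in strata $B_j$ with $j\le i$ and atoms of negative conditions in strata $B_j$ with $j<i$. A program is *temporally stratified* if the program obtained by deleting all object terms (each predicate keeping only its time argument) is locally stratified. A Temporal Datalog$^{\rightarrow}_{\circleddash}$ program is a forward-propagating, temporally stratified set of such rules. The *perfect model* of a locally stratified program is the unique model obtained by evaluating ground rules bottom-up along a local stratification, taking in each stratum the least set closed under the rules, with $\mathsf{not}\ c$ true iff $c$ was not derived in lower strata. **The translation $\mathsf{EC2TD}$.** Predicates of $P'$: for each event type $e$ of arity $n$, a predicate $e$ of arity $n+1$; for each fluent type $f$ of arity $n$, a predicate $f^h$ of arity $n+2$ (extra arguments: value and time); if $f$ is simple, also predicates $f^i,f^t$ of arity $n+2$. Let $\mathsf{mapEC}$ send $\mathsf{happensAt}(e(\boldsymbol X),T)\mapsto e(\boldsymbol X,T)$,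 $\mathsf{initiatedAt}(f(\boldsymbol X)=v,T)\mapsto f^i(\boldsymbol X,v,T)$, $\mathsf{terminatedAt}(f(\boldsymbol X)=v,T)\mapsto f^t(\boldsymbol X,v,T)$, $\mathsf{holdsAt}(f(\boldsymbol X)=v,T)\mapsto f^h(\boldsymbol X,v,T)$. The program $P'$ consists of: - each rule of type (a) or (b) with $\mathsf{mapEC}$ applied to its head and to every body atom (negations kept); - for each simple $f$ and value $v$ of $f$: $f^h(\boldsymbol X,v,T)\leftarrow f^i(\boldsymbol X,v,T-1)$; $f^h(\boldsymbol X,v,T)\leftarrow f^h(\boldsymbol X,v,T-1),\mathsf{not}\ f^t(\boldsymbol X,v,T-1)$; and, for each value $v'\neq v$ of $f$, $f^t(\boldsymbol X,v,T)\leftarrow f^i(\boldsymbol X,v',T)$; - for each fact $\mathsf{fi}(f(\boldsymbol X)=v,f(\boldsymbol X)=v',d)$ in $P$, the rule with head $f^i(\boldsymbol X,v',T)$ and body $f^i(\boldsymbol X,v,T-d),\ \mathsf{not}\ f^t(\boldsymbol X,v,T-d+1),\dots,\mathsf{not}\ f^t(\boldsymbol X,v,T-1)$, extended, if $\mathsf{p}(f(\boldsymbol X)=v)\in P$, by $\mathsf{not}\ f^i(\boldsymbol X,v,T-d+1),\dots,\mathsf{not}\ f^i(\boldsymbol X,v,T-1)$. *)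

theory Defs
  imports Main
begin

section \<open>Normal logic programs and perfect models\<close>

datatype 'a literal = Pos 'a | Neg 'a

datatype 'a rule = Rule (head: 'a) (body: "'a literal list")

definition facts :: "'a set \<Rightarrow> 'a rule set" where
  "facts A = (\<lambda>a. Rule a []) ` A"

text \<open>A partition of the ground atoms into a sequence of strata is given by the
  function that maps each atom to the index of its stratum.\<close>

definition local_stratification :: "'a rule set \<Rightarrow> ('a \<Rightarrow> nat) \<Rightarrow> bool" where
  "local_stratification G rk \<longleftrightarrow>
     (\<forall>r\<in>G. (\<forall>b. Pos b \<in> set (body r) \<longrightarrow> rk b \<le> rk (head r)) \<and>
            (\<forall>c. Neg c \<in> set (body r) \<longrightarrow> rk c < rk (head r)))"

definition locally_stratified :: "'a rule set \<Rightarrow> bool" where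
  "locally_stratified G \<longleftrightarrow> (\<exists>rk. local_stratification G rk)"

text \<open>\<open>L\<close> is the set of atoms derived in the strata below \<open>n\<close>.\<close>

definition stratum_closed :: "'a rule set \<Rightarrow> ('a \<Rightarrow> nat) \<Rightarrow> nat \<Rightarrow> 'a set \<Rightarrow> 'a set \<Rightarrow> bool" where
  "stratum_closed G rk n L N \<longleftrightarrow> L \<subseteq> N \<and>
     (\<forall>r\<in>G. rk (head r) = n \<and> (\<forall>b. Pos b \<in> set (body r) \<longrightarrow> b \<in> N) \<and>
             (\<forall>c. Neg c \<in> set (body r) \<longrightarrow> c \<notin> L) \<longrightarrow> head r \<in> N)"

fun derived_below :: "'a rule set \<Rightarrow> ('a \<Rightarrow> nat) \<Rightarrow> nat \<Rightarrow> 'a set" where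
  "derived_below G rk 0 = {}"
| "derived_below G rk (Suc n) = \<Inter> {N. stratum_closed G rk n (derived_below G rk n) N}"

definition bottom_up_model :: "'a rule set \<Rightarrow> ('a \<Rightarrow> nat) \<Rightarrow> 'a set" where
  "bottom_up_model G rk = (\<Union>n. derived_below G rk n)"

text \<open>Lemma \<open>perfect_model_eq\<close> below shows that, for a locally stratified
  program, the description is proper: all local stratifications give the same model.\<close>

definition perfect_model :: "'a rule set \<Rightarrow> 'a set" where
  "perfect_model G = (THE M. \<exists>rk. local_stratification G rk \<and> M = bottom_up_model G rk)"


section \<open>Object terms\<close>

datatype 'o trm = Var nat | Obj 'o

primrec subst :: "(nat \<Rightarrow> 'o) \<Rightarrow> 'o trm \<Rightarrow> 'o" where
  "subst \<sigma> (Var x) = \<sigma> x"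
| "subst \<sigma> (Obj c) = c"


section \<open>Temporal Datalog\<close>

text \<open>\<open>TAtom p ts k\<close> stands for \<open>p(ts, T - k)\<close> when it occurs in a rule (where \<open>ts\<close> are
  object terms and \<open>T\<close> is the time variable of the rule), and for \<open>p(ts, k)\<close> when it is a
  ground atom (where \<open>ts\<close> are objects).\<close>

datatype ('p, 't) td_atom = TAtom (pred: 'p) (args: "'t list") (tm: int)

type_synonym ('p, 'o) td_rule = "('p, 'o trm) td_atom rule"

fun td_inst :: "(nat \<Rightarrow> 'o) \<Rightarrow> int \<Rightarrow> ('p, 'o trm) td_atom \<Rightarrow> ('p, 'o) td_atom" where
  "td_inst \<sigma> T (TAtom p ts k) = TAtom p (map (subst \<sigma>) ts) (T - k)"

text \<open>Rules are only instantiated with positive values of \<open>T\<close>. Since atoms with non-positive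
  time are then never derived, they are false in the perfect model.\<close>

definition td_ground :: "('p, 'o) td_rule set \<Rightarrow> ('p, 'o) td_atom rule set" where
  "td_ground R = {map_rule (td_inst \<sigma> T) r |r \<sigma> T. r \<in> R \<and> T \<ge> 1}"

text \<open>The arity of a predicate includes the time argument.\<close>

definition td_wf_rule :: "('p \<Rightarrow> nat) \<Rightarrow> ('p, 'o) td_rule \<Rightarrow> bool" where
  "td_wf_rule ar r \<longleftrightarrow> tm (head r) = 0 \<and>
     (\<forall>a\<in>set_rule r. length (args a) + 1 = ar (pred a))"

definition forward_propagating :: "('p, 'o) td_rule set \<Rightarrow> bool" where
  "forward_propagating R \<longleftrightarrow> (\<forall>r\<in>R. \<forall>a\<in>set_rule r. tm a \<ge> 0)"

fun delete_objects :: "('p, 't) td_atom \<Rightarrow> ('p, 't) td_atom" where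
  "delete_objects (TAtom p ts k) = TAtom p [] k"

definition temporally_stratified :: "('p, 'o) td_rule set \<Rightarrow> bool" where
  "temporally_stratified R \<longleftrightarrow>
     locally_stratified (td_ground (map_rule delete_objects ` R))"

definition temporal_datalog :: "('p \<Rightarrow> nat) \<Rightarrow> ('p, 'o) td_rule set \<Rightarrow> bool" where
  "temporal_datalog ar R \<longleftrightarrow>
     (\<forall>r\<in>R. td_wf_rule ar r) \<and> forward_propagating R \<and> temporally_stratified R"


section \<open>Event Calculus with delayed effects\<close>

text \<open>The time argument is left out here: in the rules given by the user it is always the
  time variable of the rule. Fluent values are object constants.\<close>

datatype ('e, 'f, 't, 'o) ec_atom =
  HappensAt 'e "'t list"
| InitiatedAt 'f "'t list" 'o
| TerminatedAt 'f "'t list" 'o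
| HoldsAt 'f "'t list" 'o

type_synonym ('e, 'f, 'o) ec_rule = "('e, 'f, 'o trm, 'o) ec_atom rule"

text \<open>\<open>(f, v, v', d) \<in> fis P\<close> represents the fact \<open>fi(f(X) = v, f(X) = v', d)\<close>, and
  \<open>(f, v) \<in> ps P\<close> the fact \<open>p(f(X) = v)\<close>. The domain-independent rules are the same for all
  programs and are added in \<open>ec_ground\<close>.\<close>

record ('e, 'f, 'o) ec_program =
  ev_arity :: "'e \<Rightarrow> nat"
  fl_arity :: "'f \<Rightarrow> nat"
  simple_fluent :: "'f \<Rightarrow> bool"
  vals :: "'f \<Rightarrow> 'o set"
  rules :: "('e, 'f, 'o) ec_rule set"
  fis :: "('f \<times> 'o \<times> 'o \<times> nat) set"
  ps :: "('f \<times> 'o) set"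

fun wf_atom :: "('e, 'f, 'o) ec_program \<Rightarrow> ('e, 'f, 'o trm, 'o) ec_atom \<Rightarrow> bool" where
  "wf_atom P (HappensAt e ts) \<longleftrightarrow> length ts = ev_arity P e"
| "wf_atom P (InitiatedAt f ts v) \<longleftrightarrow> length ts = fl_arity P f \<and> v \<in> vals P f"
| "wf_atom P (TerminatedAt f ts v) \<longleftrightarrow> length ts = fl_arity P f \<and> v \<in> vals P f"
| "wf_atom P (HoldsAt f ts v) \<longleftrightarrow> length ts = fl_arity P f \<and> v \<in> vals P f"

fun atom_of :: "'a literal \<Rightarrow> 'a" where
  "atom_of (Pos a) = a"
| "atom_of (Neg a) = a"

definition simple_fluent_rule :: "('e, 'f, 'o) ec_program \<Rightarrow> ('e, 'f, 'o) ec_rule \<Rightarrow> bool" where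
  "simple_fluent_rule P r \<longleftrightarrow>
     (\<exists>f ts v. (head r = InitiatedAt f ts v \<or> head r = TerminatedAt f ts v) \<and> simple_fluent P f) \<and>
     (\<exists>e ts. Pos (HappensAt e ts) \<in> set (body r)) \<and>
     (\<forall>l\<in>set (body r). (\<exists>e ts. atom_of l = HappensAt e ts) \<or> (\<exists>g ts v. atom_of l = HoldsAt g ts v))"

definition static_fluent_rule :: "('e, 'f, 'o) ec_program \<Rightarrow> ('e, 'f, 'o) ec_rule \<Rightarrow> bool" where
  "static_fluent_rule P r \<longleftrightarrow>
     (\<exists>f ts v. head r = HoldsAt f ts v \<and> \<not> simple_fluent P f) \<and>
     body r \<noteq> [] \<and>
     (\<forall>l\<in>set (body r). \<exists>g ts v. atom_of l = HoldsAt g ts v)"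

definition static_deps :: "('e, 'f, 'o) ec_program \<Rightarrow> ('f \<times> 'f) set" where
  "static_deps P = {(f, g). \<exists>r\<in>rules P. \<exists>ts v l ts' v'. head r = HoldsAt f ts v \<and>
     l \<in> set (body r) \<and> atom_of l = HoldsAt g ts' v'}"

definition ec_de_program :: "('e, 'f, 'o) ec_program \<Rightarrow> bool" where
  "ec_de_program P \<longleftrightarrow>
     finite (rules P) \<and> finite (fis P) \<and> finite (ps P) \<and>
     (\<forall>r\<in>rules P. (simple_fluent_rule P r \<or> static_fluent_rule P r) \<and>
                    (\<forall>a\<in>set_rule r. wf_atom P a)) \<and>
     (\<forall>(f, v, v', d)\<in>fis P. simple_fluent P f \<and> v \<in> vals P f \<and> v' \<in> vals P f \<and> d > 0) \<and>
     (\<forall>(f, v)\<in>ps P. simple_fluent P f \<and> v \<in> vals P f) \<and>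
     acyclic (static_deps P)"

text \<open>\<open>At a T\<close> is the ground atom obtained from \<open>a\<close> by adding the time argument \<open>T\<close>.
  In the remaining atoms a ground fluent-value pair \<open>f(xs) = v\<close> is given by \<open>f xs v\<close>.\<close>

datatype ('e, 'f, 'o) ec_gatom =
  At "('e, 'f, 'o, 'o) ec_atom" int
| Fi 'f "'o list" 'o 'o nat
| PFact 'f "'o list" 'o
| Cancelled 'f "'o list" 'o int int
| InitIn 'f "'o list" 'o int int
| TermIn 'f "'o list" 'o int int

fun ec_inst :: "(nat \<Rightarrow> 'o) \<Rightarrow> int \<Rightarrow> ('e, 'f, 'o trm, 'o) ec_atom \<Rightarrow> ('e, 'f, 'o) ec_gatom" where
  "ec_inst \<sigma> T (HappensAt e ts) = At (HappensAt e (map (subst \<sigma>) ts)) T"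
| "ec_inst \<sigma> T (InitiatedAt f ts v) = At (InitiatedAt f (map (subst \<sigma>) ts) v) T"
| "ec_inst \<sigma> T (TerminatedAt f ts v) = At (TerminatedAt f (map (subst \<sigma>) ts) v) T"
| "ec_inst \<sigma> T (HoldsAt f ts v) = At (HoldsAt f (map (subst \<sigma>) ts) v) T"

definition ground_fluent :: "('e, 'f, 'o) ec_program \<Rightarrow> 'f \<Rightarrow> 'o list \<Rightarrow> 'o \<Rightarrow> bool" where
  "ground_fluent P f xs v \<longleftrightarrow> length xs = fl_arity P f \<and> v \<in> vals P f"

definition ground_simple :: "('e, 'f, 'o) ec_program \<Rightarrow> 'f \<Rightarrow> 'o list \<Rightarrow> 'o \<Rightarrow> bool" where
  "ground_simple P f xs v \<longleftrightarrow> simple_fluent P f \<and> ground_fluent P f xs v"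

inductive_set domain_independent :: "('e, 'f, 'o) ec_program \<Rightarrow> ('e, 'f, 'o) ec_gatom rule set"
  for P where
  delayed: "\<lbrakk>ground_simple P f xs v; ground_simple P f xs v'; T \<ge> 1; d > 0\<rbrakk> \<Longrightarrow>
    Rule (At (InitiatedAt f xs v') (T + int d))
      [Pos (Fi f xs v v' d), Pos (At (InitiatedAt f xs v) T), Neg (Cancelled f xs v T (T + int d))]
      \<in> domain_independent P"
| cancelled_term: "\<lbrakk>ground_simple P f xs v; T \<ge> 1; d > 0\<rbrakk> \<Longrightarrow>
    Rule (Cancelled f xs v T (T + int d)) [Pos (TermIn f xs v T (T + int d))]
      \<in> domain_independent P"
| cancelled_init: "\<lbrakk>ground_simple P f xs v; T \<ge> 1; d > 0\<rbrakk> \<Longrightarrow>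
    Rule (Cancelled f xs v T (T + int d)) [Pos (PFact f xs v), Pos (InitIn f xs v T (T + int d))]
      \<in> domain_independent P"
| holds_init: "\<lbrakk>ground_simple P f xs v; T \<ge> 1\<rbrakk> \<Longrightarrow>
    Rule (At (HoldsAt f xs v) T) [Pos (At (InitiatedAt f xs v) (T - 1))]
      \<in> domain_independent P"
| inertia: "\<lbrakk>ground_simple P f xs v; T \<ge> 1\<rbrakk> \<Longrightarrow>
    Rule (At (HoldsAt f xs v) T)
      [Pos (At (HoldsAt f xs v) (T - 1)), Neg (At (TerminatedAt f xs v) (T - 1))]
      \<in> domain_independent P"
| other_value: "\<lbrakk>ground_simple P f xs v; ground_simple P f xs v'; v' \<noteq> v; T \<ge> 1\<rbrakk> \<Longrightarrow>
    Rule (At (TerminatedAt f xs v) T) [Pos (At (InitiatedAt f xs v') T)]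
      \<in> domain_independent P"
| init_in: "\<lbrakk>ground_simple P f xs v; T1 \<ge> 1; T1 < T; T < T2\<rbrakk> \<Longrightarrow>
    Rule (InitIn f xs v T1 T2) [Pos (At (InitiatedAt f xs v) T)]
      \<in> domain_independent P"
| term_in: "\<lbrakk>ground_simple P f xs v; T1 \<ge> 1; T1 < T; T < T2\<rbrakk> \<Longrightarrow>
    Rule (TermIn f xs v T1 T2) [Pos (At (TerminatedAt f xs v) T)]
      \<in> domain_independent P"

definition ec_ground :: "('e, 'f, 'o) ec_program \<Rightarrow> ('e, 'f, 'o) ec_gatom rule set" where
  "ec_ground P =
     {map_rule (ec_inst \<sigma> T) r |r \<sigma> T. r \<in> rules P \<and> T \<ge> 1} \<union>
     facts {Fi f xs v v' d |f xs v v' d. (f, v, v', d) \<in> fis P \<and> length xs = fl_arity P f} \<union>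
     facts {PFact f xs v |f xs v. (f, v) \<in> ps P \<and> length xs = fl_arity P f} \<union>
     domain_independent P"

text \<open>\<open>(e, xs, s)\<close> represents the fact \<open>happensAt(e(xs), s)\<close>.\<close>

type_synonym ('e, 'o) stream = "('e \<times> 'o list \<times> int) set"

definition is_stream :: "('e, 'f, 'o) ec_program \<Rightarrow> ('e, 'o) stream \<Rightarrow> bool" where
  "is_stream P S \<longleftrightarrow> (\<forall>(e, xs, s)\<in>S. length xs = ev_arity P e \<and> s \<ge> 1)"

definition ec_stream :: "('e, 'o) stream \<Rightarrow> ('e, 'f, 'o) ec_gatom rule set" where
  "ec_stream S = facts {At (HappensAt e xs) s |e xs s. (e, xs, s) \<in> S}"


section \<open>The translation\<close>

text \<open>\<open>Init f\<close>, \<open>Term f\<close> and \<open>Holds f\<close> are the predicates \<open>f\<^sup>i\<close>, \<open>f\<^sup>t\<close> and \<open>f\<^sup>h\<close>.\<close>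

datatype ('e, 'f) td_pred = Event 'e | Init 'f | Term 'f | Holds 'f

fun td_arity :: "('e, 'f, 'o) ec_program \<Rightarrow> ('e, 'f) td_pred \<Rightarrow> nat" where
  "td_arity P (Event e) = ev_arity P e + 1"
| "td_arity P (Init f) = fl_arity P f + 2"
| "td_arity P (Term f) = fl_arity P f + 2"
| "td_arity P (Holds f) = fl_arity P f + 2"

fun mapEC :: "('e, 'f, 'o trm, 'o) ec_atom \<Rightarrow> (('e, 'f) td_pred, 'o trm) td_atom" where
  "mapEC (HappensAt e ts) = TAtom (Event e) ts 0"
| "mapEC (InitiatedAt f ts v) = TAtom (Init f) (ts @ [Obj v]) 0"
| "mapEC (TerminatedAt f ts v) = TAtom (Term f) (ts @ [Obj v]) 0"
| "mapEC (HoldsAt f ts v) = TAtom (Holds f) (ts @ [Obj v]) 0"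

text \<open>The argument tuple \<open>X, v\<close> for a tuple \<open>X\<close> of distinct variables.\<close>

definition fl_args :: "('e, 'f, 'o) ec_program \<Rightarrow> 'f \<Rightarrow> 'o \<Rightarrow> 'o trm list" where
  "fl_args P f v = map Var [0..<fl_arity P f] @ [Obj v]"

definition fi_rule ::
  "('e, 'f, 'o) ec_program \<Rightarrow> 'f \<Rightarrow> 'o \<Rightarrow> 'o \<Rightarrow> nat \<Rightarrow> (('e, 'f) td_pred, 'o) td_rule" where
  "fi_rule P f v v' d =
     Rule (TAtom (Init f) (fl_args P f v') 0)
       (Pos (TAtom (Init f) (fl_args P f v) (int d)) #
        map (\<lambda>k. Neg (TAtom (Term f) (fl_args P f v) (int k))) (rev [1..<d]) @
        (if (f, v) \<in> ps P
         then map (\<lambda>k. Neg (TAtom (Init f) (fl_args P f v) (int k))) (rev [1..<d])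
         else []))"

definition EC2TD :: "('e, 'f, 'o) ec_program \<Rightarrow> (('e, 'f) td_pred, 'o) td_rule set" where
  "EC2TD P =
     map_rule mapEC ` rules P \<union>
     {Rule (TAtom (Holds f) (fl_args P f v) 0) [Pos (TAtom (Init f) (fl_args P f v) 1)] |f v.
        simple_fluent P f \<and> v \<in> vals P f} \<union>
     {Rule (TAtom (Holds f) (fl_args P f v) 0)
        [Pos (TAtom (Holds f) (fl_args P f v) 1), Neg (TAtom (Term f) (fl_args P f v) 1)] |f v.
        simple_fluent P f \<and> v \<in> vals P f} \<union>
     {Rule (TAtom (Term f) (fl_args P f v) 0) [Pos (TAtom (Init f) (fl_args P f v') 0)] |f v v'.
        simple_fluent P f \<and> v \<in> vals P f \<and> v' \<in> vals P f \<and> v' \<noteq> v} \<union>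
     {fi_rule P f v v' d |f v v' d. (f, v, v', d) \<in> fis P}"

definition td_stream :: "('e, 'o) stream \<Rightarrow> (('e, 'f) td_pred, 'o) td_atom rule set" where
  "td_stream S = facts {TAtom (Event e) xs s |e xs s. (e, xs, s) \<in> S}"


section \<open>Well-definedness of the perfect model\<close>

inductive_set reduct_model :: "'a rule set \<Rightarrow> 'a set \<Rightarrow> 'a set" for G M where
  "\<lbrakk>r \<in> G; \<forall>b. Pos b \<in> set (body r) \<longrightarrow> b \<in> reduct_model G M;
    \<forall>c. Neg c \<in> set (body r) \<longrightarrow> c \<notin> M\<rbrakk> \<Longrightarrow> head r \<in> reduct_model G M"

lemma derived_below_closed:
  "stratum_closed G rk n (derived_below G rk n) (derived_below G rk (Suc n))"
  unfolding stratum_closed_def derived_below.simps by blast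

lemma derived_below_least:
  "stratum_closed G rk n (derived_below G rk n) N \<Longrightarrow> derived_below G rk (Suc n) \<subseteq> N"
  by auto

declare derived_below.simps(2) [simp del]

lemma derived_below_Suc_cases:
  assumes "a \<in> derived_below G rk (Suc n)"
  shows "a \<in> derived_below G rk n \<or> rk a = n"
proof -
  have "stratum_closed G rk n (derived_below G rk n) (derived_below G rk n \<union> {a. rk a = n})"
    by (simp add: stratum_closed_def)
  from derived_below_least[OF this] assms show ?thesis by auto
qed

lemma derived_below_rank: "a \<in> derived_below G rk n \<Longrightarrow> rk a < n"
  by (induction n arbitrary: a) (auto dest!: derived_below_Suc_cases intro: less_SucI)

lemma derived_below_mono: "m \<le> n \<Longrightarrow> derived_below G rk m \<subseteq> derived_below G rk n"
  by (rule lift_Suc_mono_le) (use derived_below_closed[of G rk] in \<open>simp_all only: stratum_closed_def\<close>)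

lemma bottom_up_model_rank:
  assumes "rk a < n" "a \<in> bottom_up_model G rk"
  shows "a \<in> derived_below G rk n"
proof -
  from assms(2) obtain m where "a \<in> derived_below G rk m"
    unfolding bottom_up_model_def by (rule UN_E)
  then show ?thesis
  proof (induction m)
    case 0
    then show ?case by simp
  next
    case (Suc m)
    show ?case
    proof (cases "a \<in> derived_below G rk m")
      case True
      then show ?thesis by (rule Suc.IH)
    next
      case False
      with Suc.prems have "Suc m \<le> n"
        using derived_below_Suc_cases[of a G rk m] assms(1) by simp
      from derived_below_mono[OF this] Suc.prems show ?thesis by (rule subsetD)
    qed
  qed
qed

lemma bottom_up_model_stable:
  assumes st: "local_stratification G rk"
  shows "reduct_model G (bottom_up_model G rk) = bottom_up_model G rk"
proof
  let ?M = "bottom_up_model G rk"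
  let ?D = "derived_below G rk"
  have D_sub: "?D n \<subseteq> ?M" for n by (auto simp: bottom_up_model_def)
  show "reduct_model G ?M \<subseteq> ?M"
  proof
    fix a assume "a \<in> reduct_model G ?M"
    then show "a \<in> ?M"
    proof induction
      case (1 r)
      let ?n = "rk (head r)"
      have pos: "b \<in> ?D (Suc ?n)" if b: "Pos b \<in> set (body r)" for b
      proof (rule bottom_up_model_rank)
        show "rk b < Suc ?n" using st 1(1) b by (simp add: local_stratification_def less_Suc_eq_le)
        show "b \<in> ?M" using "1.IH" b by simp
      qed
      have neg: "c \<notin> ?D ?n" if "Neg c \<in> set (body r)" for c
        using "1.hyps"(2) that subsetD[OF D_sub, of c ?n] by metis
      have "head r \<in> ?D (Suc ?n)"
        using derived_below_closed[of G rk ?n] 1(1) pos neg by (simp add: stratum_closed_def)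
      then show ?case by (rule subsetD[OF D_sub])
    qed
  qed
  have "?D n \<subseteq> reduct_model G ?M" for n
  proof (induction n)
    case 0
    show ?case by simp
  next
    case (Suc n)
    let ?N = "reduct_model G ?M"
    have "head r \<in> ?N" if r: "r \<in> G" "rk (head r) = n"
      "\<forall>b. Pos b \<in> set (body r) \<longrightarrow> b \<in> ?N" "\<forall>c. Neg c \<in> set (body r) \<longrightarrow> c \<notin> ?D n" for r
    proof (rule reduct_model.intros[OF r(1,3)], intro allI impI notI)
      fix c assume c: "Neg c \<in> set (body r)" "c \<in> ?M"
      have "rk c < n" using st r(1,2) c(1) by (auto simp: local_stratification_def)
      from bottom_up_model_rank[of rk c n G, OF this c(2)] r(4) c(1) show False by simp
    qed
    then have "stratum_closed G rk n (?D n) ?N"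
      using Suc by (simp add: stratum_closed_def)
    then show ?case by (rule derived_below_least)
  qed
  then show "?M \<subseteq> reduct_model G ?M" unfolding bottom_up_model_def by (rule UN_least)
qed

lemma stable_unique:
  assumes st: "local_stratification G rk"
    and M: "reduct_model G M = M" and N: "reduct_model G N = N"
  shows "M = N"
proof -
  have sub: "a \<in> reduct_model G B"
    if agree: "\<And>c. rk c < n \<Longrightarrow> c \<in> A \<longleftrightarrow> c \<in> B" and a: "a \<in> reduct_model G A" "rk a \<le> n"
    for A B a n
    using a
  proof (induction rule: reduct_model.induct)
    case (1 r)
    show ?case
    proof (rule reduct_model.intros[OF 1(1)]; intro allI impI)
      fix b assume b: "Pos b \<in> set (body r)"
      then have "rk b \<le> n" using st 1 by (force simp: local_stratification_def)
      then show "b \<in> reduct_model G B" using 1 b by blast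
    next
      fix c assume c: "Neg c \<in> set (body r)"
      then have "rk c < n" using st 1 by (force simp: local_stratification_def)
      then show "c \<notin> B" using 1 c agree by blast
    qed
  qed
  have "\<forall>a. rk a = n \<longrightarrow> (a \<in> M \<longleftrightarrow> a \<in> N)" for n
  proof (induction n rule: less_induct)
    case (less n)
    then have agree: "\<And>c. rk c < n \<Longrightarrow> c \<in> M \<longleftrightarrow> c \<in> N" by blast
    show ?case
    proof (intro allI impI iffI)
      fix a assume "rk a = n" "a \<in> M"
      with sub[of n M N a, OF agree] M N show "a \<in> N" by simp
    next
      fix a assume "rk a = n" "a \<in> N"
      with sub[of n N M a, OF agree[symmetric]] M N show "a \<in> M" by simp
    qed
  qed
  then show ?thesis by blast
qed

lemma perfect_model_eq:
  assumes "local_stratification G rk"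
  shows "perfect_model G = bottom_up_model G rk"
  unfolding perfect_model_def
proof (rule the_equality)
  show "\<exists>rk'. local_stratification G rk' \<and> bottom_up_model G rk = bottom_up_model G rk'"
    using assms by blast
next
  fix M assume "\<exists>rk'. local_stratification G rk' \<and> M = bottom_up_model G rk'"
  then have "reduct_model G M = M" by (auto simp: bottom_up_model_stable)
  with assms show "M = bottom_up_model G rk"
    by (rule stable_unique) (rule bottom_up_model_stable[OF assms])
qed

lemma perfect_model_stable:
  assumes "local_stratification G rk"
  shows "reduct_model G (perfect_model G) = perfect_model G"
  using assms by (simp add: perfect_model_eq bottom_up_model_stable)

lemma ec_locally_stratified:
  fixes P :: "('e, 'f, 'o) ec_program" and S :: "('e, 'o) stream"
  assumes P: "ec_de_program P"
  shows "locally_stratified (ec_ground P \<union> ec_stream S)"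
proof -
  define D where "D = (static_deps P)\<^sup>+"
  define N where "N = card (Range D)"
  define lv where "lv f = card (D `` {f})" for f
  have "static_deps P \<subseteq> (\<Union>r\<in>rules P. \<Union>l\<in>set (body r).
      {case head r of HoldsAt f ts v \<Rightarrow> f} \<times> {case atom_of l of HoldsAt f ts v \<Rightarrow> f})"
    unfolding static_deps_def by force
  moreover have "finite (rules P)" using P by (simp add: ec_de_program_def)
  ultimately have "finite (static_deps P)" by (auto elim: finite_subset)
  then have fin: "finite (Range D)" by (simp add: D_def trancl_range finite_Range)
  have finI: "finite (D `` {f})" for f by (rule finite_subset[OF _ fin]) auto
  have lv_N: "lv f \<le> N" for f
    unfolding lv_def N_def by (rule card_mono[OF fin]) auto
  then have lv_N': "lv f < k + N" if "k > 0" for f k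
    by (rule le_less_trans) (use that in simp)
  have acyc: "(f, f) \<notin> D" for f
    using P by (auto simp: ec_de_program_def acyclic_def D_def)
  have lv_less: "lv g < lv f" if "(f, g) \<in> static_deps P" for f g
  proof -
    have fg: "(f, g) \<in> D" using that by (simp add: D_def)
    have "D `` {g} \<subset> D `` {f}"
    proof
      show "D `` {g} \<subseteq> D `` {f}" using fg unfolding D_def by (auto intro: trancl_trans)
      show "D `` {g} \<noteq> D `` {f}" using fg acyc by blast
    qed
    then show ?thesis unfolding lv_def by (rule psubset_card_mono[OF finI])
  qed
  define C where "C = N + 5"
  define atm :: "('e, 'f, 'o, 'o) ec_atom \<Rightarrow> nat" where
    "atm a = (case a of HappensAt e xs \<Rightarrow> 0 | InitiatedAt f xs v \<Rightarrow> N + 3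
        | TerminatedAt f xs v \<Rightarrow> N + 4
        | HoldsAt f xs v \<Rightarrow> if simple_fluent P f then 0 else 1 + lv f)" for a
  define rk :: "('e, 'f, 'o) ec_gatom \<Rightarrow> nat" where
    "rk g = (case g of At a T \<Rightarrow> nat T * C + atm a | Fi _ _ _ _ _ \<Rightarrow> 0 | PFact _ _ _ \<Rightarrow> 0
       | Cancelled _ _ _ T T' \<Rightarrow> nat T' * C + 1
       | InitIn _ _ _ T T' \<Rightarrow> nat T' * C | TermIn _ _ _ T T' \<Rightarrow> nat T' * C)" for g
  have atm_C: "atm a < C" for a
    by (auto simp: atm_def C_def lv_N' split: ec_atom.split)
  have earlier: "rk (At a T) < nat T' * C" if "T < T'" "T' \<ge> 1" for a T T'
  proof -
    have "nat T + 1 \<le> nat T'" using that by linarith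
    then have "(nat T + 1) * C \<le> nat T' * C" by (rule mult_le_mono1)
    with atm_C[of a] show ?thesis by (simp add: rk_def algebra_simps)
  qed
  have "local_stratification (ec_ground P \<union> ec_stream S) rk"
    unfolding local_stratification_def
  proof
    fix r assume "r \<in> ec_ground P \<union> ec_stream S"
    then consider (user) r0 \<sigma> T where "r = map_rule (ec_inst \<sigma> T) r0" "r0 \<in> rules P"
      | (fact) "body r = []" | (di) "r \<in> domain_independent P"
      by (auto simp: ec_ground_def ec_stream_def facts_def)
    then show "(\<forall>b. Pos b \<in> set (body r) \<longrightarrow> rk b \<le> rk (head r)) \<and>
            (\<forall>c. Neg c \<in> set (body r) \<longrightarrow> rk c < rk (head r))"
    proof cases
      case fact
      then show ?thesis by simp
    next
      case di
      then show ?thesis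
      proof cases
        case (delayed f xs v v' T d)
        then show ?thesis using earlier[of T "T + int d"]
          by (auto simp: rk_def atm_def intro: less_imp_le trans_less_add1)
      next
        case (other_value f xs v v' T)
        then show ?thesis by (simp add: rk_def atm_def)
      next
        case (holds_init f xs v T)
        then show ?thesis using earlier[of "T - 1" T]
          by (auto simp: rk_def[of "At _ T"] intro: less_imp_le trans_less_add1)
      next
        case (inertia f xs v T)
        then show ?thesis using earlier[of "T - 1" T]
          by (auto simp: rk_def[of "At _ T"] intro: less_imp_le trans_less_add1)
      next
        case (init_in f xs v T1 T T2)
        then show ?thesis using earlier[of T T2]
          by (auto simp: rk_def[of "InitIn _ _ _ _ _"] intro: less_imp_le)
      next
        case (term_in f xs v T1 T T2)
        then show ?thesis using earlier[of T T2]
          by (auto simp: rk_def[of "TermIn _ _ _ _ _"] intro: less_imp_le)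
      qed (auto simp: rk_def)
    next
      case (user r0 \<sigma> T)
      have less: "rk (ec_inst \<sigma> T (atom_of l)) < rk (head r)" if l: "l \<in> set (body r0)" for l
      proof -
        have hd: "head r = ec_inst \<sigma> T (head r0)" using user by (cases r0) simp
        have "simple_fluent_rule P r0 \<or> static_fluent_rule P r0"
          using P user by (auto simp: ec_de_program_def)
        then show ?thesis
        proof
          assume s: "simple_fluent_rule P r0"
          then have "N + 3 + nat T * C \<le> rk (head r)"
            by (auto simp: hd simple_fluent_rule_def rk_def atm_def)
          moreover have "rk (ec_inst \<sigma> T (atom_of l)) < N + 3 + nat T * C"
          proof -
            from s l consider e ts where "atom_of l = HappensAt e ts" | g ts v where "atom_of l = HoldsAt g ts v"
              unfolding simple_fluent_rule_def by metis
            then show ?thesis by cases (simp_all add: rk_def atm_def lv_N less_Suc_eq_le le_SucI)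
          qed
          ultimately show ?thesis by simp
        next
          assume s: "static_fluent_rule P r0"
          then obtain f ts v where f: "head r0 = HoldsAt f ts v" "\<not> simple_fluent P f"
            by (auto simp: static_fluent_rule_def)
          from s l obtain g ts' v' where g: "atom_of l = HoldsAt g ts' v'"
            by (auto simp: static_fluent_rule_def)
          have "(f, g) \<in> static_deps P"
            unfolding static_deps_def mem_Collect_eq case_prod_conv
            by (intro bexI[of _ r0] exI conjI) (fact f(1) l g user(2))+
          from lv_less[OF this] f g show ?thesis by (simp add: hd rk_def atm_def)
        qed
      qed
      have "set (body r) = map_literal (ec_inst \<sigma> T) ` set (body r0)"
        using user by (cases r0) simp
      then have "\<exists>l\<in>set (body r0). a = ec_inst \<sigma> T (atom_of l)"
        if "Pos a \<in> set (body r) \<or> Neg a \<in> set (body r)" for a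
      proof -
        from that \<open>set (body r) = _\<close> obtain l where l: "l \<in> set (body r0)"
          "map_literal (ec_inst \<sigma> T) l = Pos a \<or> map_literal (ec_inst \<sigma> T) l = Neg a"
          by (metis imageE)
        from l(2) have "a = ec_inst \<sigma> T (atom_of l)" by (cases l) simp_all
        with l(1) show ?thesis by (rule rev_bexI)
      qed
      with less show ?thesis by (metis less_imp_le)
    qed
  qed
  then show ?thesis unfolding locally_stratified_def by blast
qed

end

theory Submission
  imports Defs
begin

text \<open>Every condition of a rule of the translation either lies strictly earlier than the head, or
  is simultaneous with it and has a predicate of smaller level. Hence time together with the level
  is a stratification, and it ignores object arguments. A program with a local stratification has
  exactly one stable model, so it suffices to show that the image under the translation of
  the perfect model of the Event Calculus program is stable for the translated program. The
  translation can drop \<open>Cancelled\<close>, \<open>InitIn\<close> and \<open>TermIn\<close> because their truth in the former model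
  is determined by initiations and terminations.\<close>

section \<open>Temporal stratification of the translation\<close>

lemma Pos_in_body_map_rule:
  "Pos b \<in> set (body (map_rule f r)) \<longleftrightarrow> (\<exists>c. Pos c \<in> set (body r) \<and> b = f c)"
proof -
  have "Pos b = map_literal f l \<longleftrightarrow> (\<exists>c. l = Pos c \<and> b = f c)" for l by (cases l) auto
  then show ?thesis by (cases r) (auto simp: image_iff)
qed

lemma Neg_in_body_map_rule:
  "Neg b \<in> set (body (map_rule f r)) \<longleftrightarrow> (\<exists>c. Neg c \<in> set (body r) \<and> b = f c)"
proof -
  have "Neg b = map_literal f l \<longleftrightarrow> (\<exists>c. l = Neg c \<and> b = f c)" for l by (cases l) auto
  then show ?thesis by (cases r) (auto simp: image_iff)
qed

lemma atom_of_map_literal [simp]: "atom_of (map_literal f l) = f (atom_of l)"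
  by (cases l) auto

lemma body_map_rule: "body (map_rule f r) = map (map_literal f) (body r)"
  by (cases r) simp

lemma head_map_rule: "head (map_rule f r) = f (head r)"
  by (cases r) simp

lemma set_rule_conv: "set_rule r = insert (head r) (atom_of ` set (body r))"
proof -
  have "set_literal l = {atom_of l}" for l :: "'a literal" by (cases l) auto
  then show ?thesis by (cases r) auto
qed

section \<open>Levels of predicates and the stratifications they induce\<close>

lemma td_inst_simps [simp]:
  "pred (td_inst \<sigma> T a) = pred a" "tm (td_inst \<sigma> T a) = T - tm a"
  by (cases a; simp)+

lemma delete_objects_simps [simp]:
  "pred (delete_objects a) = pred a" "tm (delete_objects a) = tm a"
  by (cases a; simp)+

text \<open>In a non-ground rule \<open>tm\<close> counts backwards from the time variable, so
  \<open>tm \<ge> 1\<close> means strictly before the head. Positive conditions get the same strict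
  bound as negative ones. Only predicates and offsets are inspected, so the property survives both
  grounding and the deletion of objects.\<close>

definition level_decreasing :: "('p \<Rightarrow> nat) \<Rightarrow> ('p, 't) td_atom rule \<Rightarrow> bool" where
  "level_decreasing lvl r \<longleftrightarrow> tm (head r) = 0 \<and>
     (\<forall>l\<in>set (body r). tm (atom_of l) \<ge> 1 \<or>
        tm (atom_of l) = 0 \<and> lvl (pred (atom_of l)) < lvl (pred (head r)))"

lemma level_decreasing_delete_objects:
  "level_decreasing lvl r \<Longrightarrow> level_decreasing lvl (map_rule delete_objects r)"
  by (auto simp: level_decreasing_def head_map_rule body_map_rule)

text \<open>The rank is the lexicographic order on time and level, written as one number in base
  \<open>C\<close>. Levels stay below \<open>C\<close>, so one step back in time outweighs any
  increase of level.\<close>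

lemma td_ground_local_stratification:
  assumes R: "\<And>r. r \<in> R \<Longrightarrow> level_decreasing lvl r" and C: "\<And>p. lvl p < C"
  shows "local_stratification (td_ground R) (\<lambda>a. nat (tm a) * C + lvl (pred a))"
proof -
  have less: "nat (T - tm a) * C + lvl (pred a) < nat T * C + lvl q"
    if "T \<ge> 1" "tm a \<ge> 1 \<or> tm a = 0 \<and> lvl (pred a) < lvl q" for T q and a :: "('a, 'b trm) td_atom"
  proof (cases "tm a \<ge> 1")
    case True
    \<comment> \<open>The time \<open>T - tm a\<close> may be negative, where \<open>nat\<close>
      yields 0; the inequality survives because \<open>T \<ge> 1\<close>.\<close>
    then have "Suc (nat (T - tm a)) \<le> nat T" using that(1) by linarith
    then have "Suc (nat (T - tm a)) * C \<le> nat T * C" by (rule mult_le_mono1)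
    with C[of "pred a"] show ?thesis by simp
  next
    case False
    then show ?thesis using that by simp
  qed
  show ?thesis
    unfolding local_stratification_def
  proof
    fix r assume "r \<in> td_ground R"
    then obtain r0 \<sigma> T where r: "r = map_rule (td_inst \<sigma> T) r0" "r0 \<in> R" "T \<ge> 1"
      by (auto simp: td_ground_def)
    have "nat (T - tm (atom_of l)) * C + lvl (pred (atom_of l)) < nat T * C + lvl (pred (head r0))"
      if "l \<in> set (body r0)" for l
      using R[OF r(2)] that less[OF r(3)] by (auto simp: level_decreasing_def)
    note this[of "Pos _", simplified] this[of "Neg _", simplified]
    then show "(\<forall>b. Pos b \<in> set (body r) \<longrightarrow>
        nat (tm b) * C + lvl (pred b) \<le> nat (tm (head r)) * C + lvl (pred (head r))) \<and>
      (\<forall>c. Neg c \<in> set (body r) \<longrightarrow>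
        nat (tm c) * C + lvl (pred c) < nat (tm (head r)) * C + lvl (pred (head r)))"
      using R[OF r(2)]
      by (auto simp: r(1) Pos_in_body_map_rule Neg_in_body_map_rule head_map_rule level_decreasing_def
          intro: less_imp_le)
  qed
qed

text \<open>The level of a fluent is the number of fluents reachable from it through static
  definitions. Finitely many rules make this number finite and bounded. If \<open>f\<close> depends
  on \<open>g\<close>, then all that \<open>g\<close> reaches is reached by \<open>f\<close>, and by
  acyclicity \<open>g\<close> is reached by \<open>f\<close> but not by itself, so the count
  drops.\<close>

lemma ex_static_level:
  fixes P :: "('e, 'f, 'o) ec_program"
  assumes "ec_de_program P"
  obtains lv :: "'f \<Rightarrow> nat" and N
  where "\<And>f. lv f \<le> N" and "\<And>f g. (f, g) \<in> static_deps P \<Longrightarrow> lv g < lv f"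
proof
  let ?D = "(static_deps P)\<^sup>+"
  \<comment> \<open>Each pair of literal and rule contributes one dependency at most. For atoms
    other than \<open>HoldsAt\<close> the case expressions are unspecified, which only enlarges this
    finite superset.\<close>
  have "static_deps P \<subseteq> (\<Union>r\<in>rules P. \<Union>l\<in>set (body r).
      {case head r of HoldsAt f ts v \<Rightarrow> f} \<times> {case atom_of l of HoldsAt f ts v \<Rightarrow> f})"
    unfolding static_deps_def by force
  moreover have "finite (rules P)" using assms by (simp add: ec_de_program_def)
  ultimately have "finite (static_deps P)" by (auto elim: finite_subset)
  then have fin: "finite (Range ?D)" by (simp add: trancl_range finite_Range)
  show "card (?D `` {f}) \<le> card (Range ?D)" for f
    by (rule card_mono[OF fin]) blast
  show "card (?D `` {g}) < card (?D `` {f})" if "(f, g) \<in> static_deps P" for f g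
  proof (rule psubset_card_mono)
    show "finite (?D `` {f})" by (rule finite_subset[OF _ fin]) blast
    have "(g, g) \<notin> ?D" using assms by (auto simp: ec_de_program_def acyclic_def)
    then show "?D `` {g} \<subset> ?D `` {f}" using that by (auto intro: trancl_into_trancl2)
  qed
qed

section \<open>Levels and well-formedness of the translated rules\<close>

lemma tm_mapEC [simp]: "tm (mapEC a) = 0"
  by (cases a) auto

lemma EC2TD_cases:
  assumes "r \<in> EC2TD P"
  obtains (user) r0 where "r0 \<in> rules P" "r = map_rule mapEC r0"
  | (holds_init) f v where "simple_fluent P f" "v \<in> vals P f"
      "r = Rule (TAtom (Holds f) (fl_args P f v) 0) [Pos (TAtom (Init f) (fl_args P f v) 1)]"
  | (inertia) f v where "simple_fluent P f" "v \<in> vals P f"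
      "r = Rule (TAtom (Holds f) (fl_args P f v) 0)
        [Pos (TAtom (Holds f) (fl_args P f v) 1), Neg (TAtom (Term f) (fl_args P f v) 1)]"
  | (other_value) f v v' where "simple_fluent P f" "v \<in> vals P f" "v' \<in> vals P f" "v' \<noteq> v"
      "r = Rule (TAtom (Term f) (fl_args P f v) 0) [Pos (TAtom (Init f) (fl_args P f v') 0)]"
  | (delayed) f v v' d where "(f, v, v', d) \<in> fis P" "r = fi_rule P f v v' d"
  using assms unfolding EC2TD_def by blast

lemma EC2TD_level_decreasing:
  fixes P :: "('e, 'f, 'o) ec_program"
  assumes P: "ec_de_program P"
  obtains lvl :: "('e, 'f) td_pred \<Rightarrow> nat" and C
  where "\<And>p. lvl p < C" and "\<And>r. r \<in> EC2TD P \<Longrightarrow> level_decreasing lvl r"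
proof -
  obtain lv :: "'f \<Rightarrow> nat" and N
    where N: "\<And>f. lv f \<le> N" and lv: "\<And>f g. (f, g) \<in> static_deps P \<Longrightarrow> lv g < lv f"
    using ex_static_level[OF P] by metis
  \<comment> \<open>The order in which predicates are evaluated within one time-point: events and
    simple fluents, whose \<open>Holds\<close> rules look back one step; then static fluents by
    dependency depth, up to level \<open>N + 1\<close>; then initiations, whose rules may query all
    of these; then terminations, which may also follow from simultaneous initiations.\<close>
  define lvl :: "('e, 'f) td_pred \<Rightarrow> nat" where
    "lvl p = (case p of Event e \<Rightarrow> 0 | Holds f \<Rightarrow> if simple_fluent P f then 0 else Suc (lv f)
        | Init f \<Rightarrow> N + 2 | Term f \<Rightarrow> N + 3)" for p
  have "lv f < 3 + N" for f using N[of f] by simp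
  then have "lvl p < N + 4" for p
    by (simp add: lvl_def split: td_pred.split)
  moreover have "level_decreasing lvl r" if "r \<in> EC2TD P" for r
    using that
  proof (cases rule: EC2TD_cases)
    case (user r0)
    have "lvl (pred (mapEC (atom_of l))) < lvl (pred (mapEC (head r0)))" if l: "l \<in> set (body r0)" for l
    proof -
      have "simple_fluent_rule P r0 \<or> static_fluent_rule P r0"
        using P user by (auto simp: ec_de_program_def)
      then show ?thesis
      proof
        assume s: "simple_fluent_rule P r0"
        then have "N + 2 \<le> lvl (pred (mapEC (head r0)))"
          by (auto simp: simple_fluent_rule_def lvl_def)
        moreover have "lvl (pred (mapEC (atom_of l))) < N + 2"
        proof -
          from s l consider e ts where "atom_of l = HappensAt e ts" | g ts v where "atom_of l = HoldsAt g ts v"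
            unfolding simple_fluent_rule_def by metis
          then show ?thesis by cases (use N in \<open>auto simp: lvl_def less_Suc_eq_le\<close>)
        qed
        ultimately show ?thesis by simp
      next
        assume s: "static_fluent_rule P r0"
        then obtain f ts v where f: "head r0 = HoldsAt f ts v" "\<not> simple_fluent P f"
          by (auto simp: static_fluent_rule_def)
        from s l obtain g ts' v' where g: "atom_of l = HoldsAt g ts' v'"
          by (auto simp: static_fluent_rule_def)
        have "(f, g) \<in> static_deps P"
          unfolding static_deps_def mem_Collect_eq case_prod_conv
          by (intro bexI[of _ r0] exI conjI) (fact f(1) l g user(1))+
        from lv[OF this] f g show ?thesis by (simp add: lvl_def)
      qed
    qed
    then show ?thesis
      by (auto simp: user(2) level_decreasing_def head_map_rule body_map_rule)
  next
    case (delayed f v v' d)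
    \<comment> \<open>A positive delay puts the condition at offset \<open>d\<close> strictly before
      the head; the negated conditions have offsets at least 1 by their range.\<close>
    then have "d > 0" using P by (auto simp: ec_de_program_def)
    then show ?thesis by (auto simp: delayed(2) level_decreasing_def fi_rule_def)
  qed (auto simp: level_decreasing_def lvl_def)
  ultimately show ?thesis by (rule that)
qed

lemma EC2TD_wf_rule:
  fixes P :: "('e, 'f, 'o) ec_program"
  assumes P: "ec_de_program P" and r: "r \<in> EC2TD P"
  shows "td_wf_rule (td_arity P) r"
proof -
  have len: "length (fl_args P f v) = Suc (fl_arity P f)" for f v
    by (simp add: fl_args_def)
  show ?thesis using r
  proof (cases rule: EC2TD_cases)
    case (user r0)
    have "length (args (mapEC a)) + 1 = td_arity P (pred (mapEC a))" if "wf_atom P a" for a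
      using that by (cases a) auto
    then show ?thesis using P user
      by (auto simp: td_wf_rule_def ec_de_program_def rule.set_map head_map_rule)
  next
    case (delayed f v v' d)
    then show ?thesis by (auto simp: td_wf_rule_def set_rule_conv fi_rule_def len)
  qed (simp_all add: td_wf_rule_def set_rule_conv len)
qed

text \<open>One level function serves twice: its offsets are 0 or at least 1, which is forward
  propagation, and it remains decreasing once the objects are deleted, which gives temporal
  stratification.\<close>

lemma temporal_datalog_EC2TD:
  fixes P :: "('e, 'f, 'o) ec_program"
  assumes P: "ec_de_program P"
  shows "temporal_datalog (td_arity P) (EC2TD P)"
proof -
  obtain lvl :: "('e, 'f) td_pred \<Rightarrow> nat" and C
    where C: "\<And>p. lvl p < C" and dec: "\<And>r. r \<in> EC2TD P \<Longrightarrow> level_decreasing lvl r"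
    using EC2TD_level_decreasing[OF P] by metis
  have "forward_propagating (EC2TD P)"
    using dec by (fastforce simp: forward_propagating_def level_decreasing_def set_rule_conv)
  moreover have "level_decreasing lvl r" if "r \<in> map_rule delete_objects ` EC2TD P" for r
    using that by (auto intro: level_decreasing_delete_objects dec)
  from td_ground_local_stratification[OF this C] have "temporally_stratified (EC2TD P)"
    unfolding temporally_stratified_def locally_stratified_def by blast
  ultimately show ?thesis using EC2TD_wf_rule[OF P] by (simp add: temporal_datalog_def)
qed

text \<open>Stream facts have empty bodies and so impose no condition on strata. The stratification
  is what later makes the stable model of the translation unique.\<close>

lemma translation_locally_stratified:
  fixes P :: "('e, 'f, 'o) ec_program" and S :: "('e, 'o) stream"
  assumes P: "ec_de_program P"
  obtains rk where "local_stratification (td_ground (EC2TD P) \<union> td_stream S) rk"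
proof -
  obtain lvl :: "('e, 'f) td_pred \<Rightarrow> nat" and C
    where C: "\<And>p. lvl p < C" and dec: "\<And>r. r \<in> EC2TD P \<Longrightarrow> level_decreasing lvl r"
    using EC2TD_level_decreasing[OF P] by metis
  obtain rk where "local_stratification (td_ground (EC2TD P)) rk"
    using td_ground_local_stratification[OF dec C] by blast
  moreover have "r \<in> td_stream S \<Longrightarrow> body r = []" for r :: "(('e, 'f) td_pred, 'o) td_atom rule"
    by (auto simp: td_stream_def facts_def)
  ultimately have "local_stratification (td_ground (EC2TD P) \<union> td_stream S) rk"
    unfolding local_stratification_def by (metis UnE empty_iff list.set(1))
  then show ?thesis by (rule that)
qed


section \<open>Ground rules of the translation\<close>

text \<open>Ground counterpart of \<open>mapEC\<close>, with the time made explicit. It is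
  injective, so no two timed atoms are identified.\<close>

fun td_of :: "('e, 'f, 'o, 'o) ec_atom \<Rightarrow> int \<Rightarrow> (('e, 'f) td_pred, 'o) td_atom" where
  "td_of (HappensAt e xs) T = TAtom (Event e) xs T"
| "td_of (InitiatedAt f xs v) T = TAtom (Init f) (xs @ [v]) T"
| "td_of (TerminatedAt f xs v) T = TAtom (Term f) (xs @ [v]) T"
| "td_of (HoldsAt f xs v) T = TAtom (Holds f) (xs @ [v]) T"

lemma td_of_inject: "td_of a T = td_of b T' \<longleftrightarrow> a = b \<and> T = T'"
  by (cases a; cases b) auto

abbreviation ec_atom_inst ::
  "(nat \<Rightarrow> 'o) \<Rightarrow> ('e, 'f, 'o trm, 'o) ec_atom \<Rightarrow> ('e, 'f, 'o, 'o) ec_atom" where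
  "ec_atom_inst \<sigma> \<equiv> map_ec_atom id id (subst \<sigma>) id"

lemma ec_inst_conv: "ec_inst \<sigma> T a = At (ec_atom_inst \<sigma> a) T"
  by (cases a) auto

lemma td_inst_mapEC: "td_inst \<sigma> T (mapEC a) = td_of (ec_atom_inst \<sigma> a) T"
  by (cases a) auto

text \<open>The ground instances of the translation, indexed by object tuples instead of
  substitutions and written with \<open>td_of\<close>, so that they can be matched case by case with
  \<open>domain_independent\<close> and the user rules.\<close>

inductive_set ground_translation ::
  "('e, 'f, 'o) ec_program \<Rightarrow> (('e, 'f) td_pred, 'o) td_atom rule set" for P where
  user: "\<lbrakk>r \<in> rules P; T \<ge> 1\<rbrakk> \<Longrightarrow>
    map_rule (\<lambda>a. td_of (ec_atom_inst \<sigma> a) T) r \<in> ground_translation P"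
| holds_init: "\<lbrakk>ground_simple P f xs v; T \<ge> 1\<rbrakk> \<Longrightarrow>
    Rule (td_of (HoldsAt f xs v) T) [Pos (td_of (InitiatedAt f xs v) (T - 1))]
      \<in> ground_translation P"
| inertia: "\<lbrakk>ground_simple P f xs v; T \<ge> 1\<rbrakk> \<Longrightarrow>
    Rule (td_of (HoldsAt f xs v) T)
      [Pos (td_of (HoldsAt f xs v) (T - 1)), Neg (td_of (TerminatedAt f xs v) (T - 1))]
      \<in> ground_translation P"
| other_value: "\<lbrakk>ground_simple P f xs v; ground_simple P f xs v'; v' \<noteq> v; T \<ge> 1\<rbrakk> \<Longrightarrow>
    Rule (td_of (TerminatedAt f xs v) T) [Pos (td_of (InitiatedAt f xs v') T)]
      \<in> ground_translation P"
| delayed: "\<lbrakk>(f, v, v', d) \<in> fis P; length xs = fl_arity P f; T \<ge> 1\<rbrakk> \<Longrightarrow>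
    Rule (td_of (InitiatedAt f xs v') T)
      (Pos (td_of (InitiatedAt f xs v) (T - int d)) #
       map (\<lambda>k. Neg (td_of (TerminatedAt f xs v) (T - int k))) (rev [1..<d]) @
       (if (f, v) \<in> ps P
        then map (\<lambda>k. Neg (td_of (InitiatedAt f xs v) (T - int k))) (rev [1..<d])
        else []))
      \<in> ground_translation P"

lemma subst_fl_args: "map (subst \<sigma>) (fl_args P f v) = map \<sigma> [0..<fl_arity P f] @ [v]"
  by (simp add: fl_args_def)

text \<open>The variables in \<open>fl_args\<close> are numbered from 0, so a tuple is its own
  substitution: variable \<open>n\<close> goes to entry \<open>n\<close>. This realises every tuple
  of the right length as a ground instance.\<close>

lemma subst_nth_fl_args:
  "length xs = fl_arity P f \<Longrightarrow> map (subst ((!) xs)) (fl_args P f v) = xs @ [v]"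
  by (metis subst_fl_args map_nth)

lemma td_groundI: "r \<in> R \<Longrightarrow> T \<ge> 1 \<Longrightarrow> r' = map_rule (td_inst \<sigma> T) r \<Longrightarrow> r' \<in> td_ground R"
  unfolding td_ground_def by blast

lemma td_ground_EC2TD: "td_ground (EC2TD P) = ground_translation P"
proof
  show "td_ground (EC2TD P) \<subseteq> ground_translation P"
  proof
    fix r assume "r \<in> td_ground (EC2TD P)"
    then obtain r0 \<sigma> T where r: "r = map_rule (td_inst \<sigma> T) r0" "r0 \<in> EC2TD P" "T \<ge> 1"
      by (auto simp: td_ground_def)
    let ?xs = "\<lambda>f. map \<sigma> [0..<fl_arity P f]"
    have ground: "ground_simple P f (?xs f) v" if "simple_fluent P f" "v \<in> vals P f" for f v
      using that by (simp add: ground_simple_def ground_fluent_def)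
    from r(2) show "r \<in> ground_translation P"
    proof (cases rule: EC2TD_cases)
      case (user r1)
      from ground_translation.user[OF user(1) r(3), of \<sigma>] show ?thesis
        by (simp add: r(1) user(2) rule.map_comp comp_def td_inst_mapEC)
    next
      case (holds_init f v)
      from ground_translation.holds_init[OF ground[OF this(1,2)] r(3)] this(3) show ?thesis
        by (simp add: r(1) subst_fl_args)
    next
      case (inertia f v)
      from ground_translation.inertia[OF ground[OF this(1,2)] r(3)] this(3) show ?thesis
        by (simp add: r(1) subst_fl_args)
    next
      case (other_value f v v')
      from ground_translation.other_value[OF ground[OF this(1,2)] ground[OF this(1,3)] this(4) r(3)] this(5)
      show ?thesis by (simp add: r(1) subst_fl_args)
    next
      case (delayed f v v' d)
      from ground_translation.delayed[OF this(1) _ r(3), of "?xs f"] this(2)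
      show ?thesis by (simp add: r(1) subst_fl_args fi_rule_def comp_def split: if_splits)
    qed
  qed
  show "ground_translation P \<subseteq> td_ground (EC2TD P)"
  proof
    fix r assume "r \<in> ground_translation P"
    then show "r \<in> td_ground (EC2TD P)"
    proof cases
      case (user r0 T \<sigma>)
      have "map_rule mapEC r0 \<in> EC2TD P" using user(2) by (simp add: EC2TD_def)
      then show ?thesis using user(3)
        by (rule td_groundI) (simp add: user(1) rule.map_comp comp_def td_inst_mapEC)
    next
      case (holds_init f xs v T)
      have "Rule (TAtom (Holds f) (fl_args P f v) 0) [Pos (TAtom (Init f) (fl_args P f v) 1)] \<in> EC2TD P"
        using holds_init(2) unfolding EC2TD_def ground_simple_def ground_fluent_def by blast
      then show ?thesis using holds_init(3)
        by (rule td_groundI[where \<sigma> = "(!) xs"])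
          (use holds_init in \<open>simp add: subst_nth_fl_args ground_simple_def ground_fluent_def\<close>)
    next
      case (inertia f xs v T)
      have "Rule (TAtom (Holds f) (fl_args P f v) 0)
          [Pos (TAtom (Holds f) (fl_args P f v) 1), Neg (TAtom (Term f) (fl_args P f v) 1)] \<in> EC2TD P"
        using inertia(2) unfolding EC2TD_def ground_simple_def ground_fluent_def by blast
      then show ?thesis using inertia(3)
        by (rule td_groundI[where \<sigma> = "(!) xs"])
          (use inertia in \<open>simp add: subst_nth_fl_args ground_simple_def ground_fluent_def\<close>)
    next
      case (other_value f xs v v' T)
      have "Rule (TAtom (Term f) (fl_args P f v) 0) [Pos (TAtom (Init f) (fl_args P f v') 0)] \<in> EC2TD P"
        using other_value(2-4) unfolding EC2TD_def ground_simple_def ground_fluent_def by blast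
      then show ?thesis using other_value(5)
        by (rule td_groundI[where \<sigma> = "(!) xs"])
          (use other_value in \<open>simp add: subst_nth_fl_args ground_simple_def ground_fluent_def\<close>)
    next
      case (delayed f v v' d xs T)
      have "fi_rule P f v v' d \<in> EC2TD P"
        using delayed(2) by (auto simp: EC2TD_def)
      then show ?thesis using delayed(4)
        by (rule td_groundI[where \<sigma> = "(!) xs"])
          (simp add: delayed(1) subst_nth_fl_args[OF delayed(3)] fi_rule_def comp_def)
    qed
  qed
qed


lemma ec_ground_stream_cases:
  assumes "r \<in> ec_ground P \<union> ec_stream S"
  obtains (user) r0 \<sigma> T where "r0 \<in> rules P" "T \<ge> 1" "r = map_rule (ec_inst \<sigma> T) r0"
  | (fi) f xs v v' d where "(f, v, v', d) \<in> fis P" "length xs = fl_arity P f"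
      "r = Rule (Fi f xs v v' d) []"
  | (p) f xs v where "(f, v) \<in> ps P" "length xs = fl_arity P f" "r = Rule (PFact f xs v) []"
  | (event) e xs s where "(e, xs, s) \<in> S" "r = Rule (At (HappensAt e xs) s) []"
  | (domain_independent) "r \<in> domain_independent P"
  using assms unfolding ec_ground_def ec_stream_def facts_def by blast


section \<open>Stable models of the Event Calculus program\<close>

text \<open>Only stability of \<open>M\<close> is assumed, not its construction along strata. All
  facts about \<open>M\<close> then come from closure under rules and from inspecting the rule that
  supports an atom.\<close>

locale ec_stable_model =
  fixes P :: "('e, 'f, 'o) ec_program" and S :: "('e, 'o) stream"
    and M :: "('e, 'f, 'o) ec_gatom set"
  assumes program: "ec_de_program P" and stream: "is_stream P S"
    and stable: "reduct_model (ec_ground P \<union> ec_stream S) M = M"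
begin

section \<open>Closure and support in a stable model\<close>

lemma rule_closed:
  assumes "r \<in> ec_ground P \<union> ec_stream S"
    and "\<forall>b. Pos b \<in> set (body r) \<longrightarrow> b \<in> M" and "\<forall>c. Neg c \<in> set (body r) \<longrightarrow> c \<notin> M"
  shows "head r \<in> M"
  using reduct_model.intros[OF assms(1), of M] assms(2,3) by (simp add: stable)

lemma domain_independent_closed:
  assumes "Rule a bs \<in> domain_independent P"
    and "\<forall>b. Pos b \<in> set bs \<longrightarrow> b \<in> M" and "\<forall>c. Neg c \<in> set bs \<longrightarrow> c \<notin> M"
  shows "a \<in> M"
  using rule_closed[of "Rule a bs"] assms by (simp add: ec_ground_def)

text \<open>The converse half of stability: an atom of \<open>M\<close> is the head of some ground
  rule whose body is true in \<open>M\<close>. With \<open>rule_closed\<close> this determines an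
  atom's truth from the rules for it.\<close>

lemma derivation:
  assumes "a \<in> M"
  obtains (user) r \<sigma> T where "r \<in> rules P" "T \<ge> 1" "a = At (ec_atom_inst \<sigma> (head r)) T"
    "\<forall>b. Pos b \<in> set (body r) \<longrightarrow> At (ec_atom_inst \<sigma> b) T \<in> M"
    "\<forall>b. Neg b \<in> set (body r) \<longrightarrow> At (ec_atom_inst \<sigma> b) T \<notin> M"
  | (fi) f xs v v' d where "(f, v, v', d) \<in> fis P" "length xs = fl_arity P f" "a = Fi f xs v v' d"
  | (p) f xs v where "(f, v) \<in> ps P" "length xs = fl_arity P f" "a = PFact f xs v"
  | (event) e xs s where "(e, xs, s) \<in> S" "a = At (HappensAt e xs) s"
  | (domain_independent) bs where "Rule a bs \<in> domain_independent P"
    "\<forall>b. Pos b \<in> set bs \<longrightarrow> b \<in> M" "\<forall>c. Neg c \<in> set bs \<longrightarrow> c \<notin> M"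
proof -
  from assms have "a \<in> reduct_model (ec_ground P \<union> ec_stream S) M" by (simp add: stable)
  then obtain r where r: "r \<in> ec_ground P \<union> ec_stream S" "a = head r"
    "\<forall>b. Pos b \<in> set (body r) \<longrightarrow> b \<in> M" "\<forall>c. Neg c \<in> set (body r) \<longrightarrow> c \<notin> M"
    by cases (auto simp: stable)
  from r(1) show thesis
  proof (cases rule: ec_ground_stream_cases)
    case u: (user r0 \<sigma> T)
    show thesis
      by (rule that(1)[OF u(1,2), of \<sigma>])
        (use u(3) r in \<open>auto simp: head_map_rule Pos_in_body_map_rule Neg_in_body_map_rule ec_inst_conv\<close>)
  next
    case f: fi
    then show thesis using that(2) r(2) by auto
  next
    case p
    then show thesis using that(3) r(2) by auto
  next
    case e: event
    then show thesis using that(4) r(2) by auto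
  next
    case d: domain_independent
    then have "Rule a (body r) \<in> domain_independent P" using r(2) by (metis rule.collapse)
    from that(5)[OF this r(3,4)] show thesis .
  qed
qed

text \<open>Rules are instantiated at positive times only and streams carry positive times. This is
  needed for delayed effects: a translated instance constrains the time of the effect, whereas
  \<open>domain_independent.delayed\<close> requires the initiation itself to be at a positive
  time.\<close>

lemma time_pos:
  assumes "At a T \<in> M"
  shows "T \<ge> 1"
  using assms
proof (cases rule: derivation)
  case (event e xs s)
  then show ?thesis using stream by (auto simp: is_stream_def)
next
  case (domain_independent bs)
  from this(1) show ?thesis by cases auto
qed auto

section \<open>Truth of the auxiliary atoms\<close>

lemma Fi_iff: "Fi f xs v v' d \<in> M \<longleftrightarrow> (f, v, v', d) \<in> fis P \<and> length xs = fl_arity P f"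
proof
  show "Fi f xs v v' d \<in> M \<Longrightarrow> (f, v, v', d) \<in> fis P \<and> length xs = fl_arity P f"
    by (erule derivation) (auto elim: domain_independent.cases)
  show "(f, v, v', d) \<in> fis P \<and> length xs = fl_arity P f \<Longrightarrow> Fi f xs v v' d \<in> M"
    using rule_closed[of "Rule (Fi f xs v v' d) []"] by (auto simp: ec_ground_def facts_def)
qed

lemma PFact_iff: "PFact f xs v \<in> M \<longleftrightarrow> (f, v) \<in> ps P \<and> length xs = fl_arity P f"
proof
  show "PFact f xs v \<in> M \<Longrightarrow> (f, v) \<in> ps P \<and> length xs = fl_arity P f"
    by (erule derivation) (auto elim: domain_independent.cases)
  show "(f, v) \<in> ps P \<and> length xs = fl_arity P f \<Longrightarrow> PFact f xs v \<in> M"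
    using rule_closed[of "Rule (PFact f xs v) []"] by (auto simp: ec_ground_def facts_def)
qed

lemma InitIn_iff:
  assumes "ground_simple P f xs v" "T1 \<ge> 1"
  shows "InitIn f xs v T1 T2 \<in> M \<longleftrightarrow> (\<exists>T. T1 < T \<and> T < T2 \<and> At (InitiatedAt f xs v) T \<in> M)"
proof
  assume "InitIn f xs v T1 T2 \<in> M"
  then show "\<exists>T. T1 < T \<and> T < T2 \<and> At (InitiatedAt f xs v) T \<in> M"
  proof (cases rule: derivation)
    case (domain_independent bs)
    from this(1) show ?thesis by cases (use domain_independent(2) in auto)
  qed auto
next
  assume "\<exists>T. T1 < T \<and> T < T2 \<and> At (InitiatedAt f xs v) T \<in> M"
  then show "InitIn f xs v T1 T2 \<in> M"
    using domain_independent_closed[OF domain_independent.init_in] assms by auto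
qed

lemma TermIn_iff:
  assumes "ground_simple P f xs v" "T1 \<ge> 1"
  shows "TermIn f xs v T1 T2 \<in> M \<longleftrightarrow> (\<exists>T. T1 < T \<and> T < T2 \<and> At (TerminatedAt f xs v) T \<in> M)"
proof
  assume "TermIn f xs v T1 T2 \<in> M"
  then show "\<exists>T. T1 < T \<and> T < T2 \<and> At (TerminatedAt f xs v) T \<in> M"
  proof (cases rule: derivation)
    case (domain_independent bs)
    from this(1) show ?thesis by cases (use domain_independent(2) in auto)
  qed auto
next
  assume "\<exists>T. T1 < T \<and> T < T2 \<and> At (TerminatedAt f xs v) T \<in> M"
  then show "TermIn f xs v T1 T2 \<in> M"
    using domain_independent_closed[OF domain_independent.term_in] assms by auto
qed

text \<open>Unfolds the auxiliary predicates down to initiations and terminations. The right-hand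
  side is what the negated conditions of \<open>fi_rule\<close> exclude, one instant at a
  time.\<close>

lemma Cancelled_iff:
  assumes g: "ground_simple P f xs v" and T: "T \<ge> 1" and d: "d > 0"
  shows "Cancelled f xs v T (T + int d) \<in> M \<longleftrightarrow>
    (\<exists>s. T < s \<and> s < T + int d \<and> (At (TerminatedAt f xs v) s \<in> M \<or>
      (f, v) \<in> ps P \<and> At (InitiatedAt f xs v) s \<in> M))"
proof -
  have "Cancelled f xs v T (T + int d) \<in> M \<longleftrightarrow> TermIn f xs v T (T + int d) \<in> M \<or>
      PFact f xs v \<in> M \<and> InitIn f xs v T (T + int d) \<in> M" (is "?L \<longleftrightarrow> ?R")
  proof
    show "?L \<Longrightarrow> ?R"
      by (erule derivation) (auto elim: domain_independent.cases)
    show "?R \<Longrightarrow> ?L"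
      using domain_independent_closed[OF domain_independent.cancelled_term[OF g T d]]
        domain_independent_closed[OF domain_independent.cancelled_init[OF g T d]] by auto
  qed
  moreover have "length xs = fl_arity P f" using g by (simp add: ground_simple_def ground_fluent_def)
  ultimately show ?thesis
    unfolding InitIn_iff[OF g T] TermIn_iff[OF g T] PFact_iff by blast
qed

section \<open>Stability of the image of the model\<close>

lemma ground_simple_fi:
  assumes "(f, v, v', d) \<in> fis P" "length xs = fl_arity P f"
  shows "ground_simple P f xs v" "ground_simple P f xs v'" "d > 0"
  using assms program by (auto simp: ec_de_program_def ground_simple_def ground_fluent_def)

text \<open>The candidate for the perfect model of the translation. Only \<open>At\<close> atoms
  have an image; the facts \<open>Fi\<close> and \<open>PFact\<close> and the cancellation atoms
  disappear.\<close>

definition td_image :: "(('e, 'f) td_pred, 'o) td_atom set" where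
  "td_image = {td_of a T |a T. At a T \<in> M}"

lemma td_of_in_image: "td_of a T \<in> td_image \<longleftrightarrow> At a T \<in> M"
  by (auto simp: td_image_def td_of_inject)

text \<open>Induction on derivations in the translation: a translated rule whose body is true in the
  image comes from a rule whose body is true in \<open>M\<close>, and \<open>M\<close> is closed.
  Only delayed effects lack a literal counterpart.\<close>

lemma reduct_sub_image: "reduct_model (td_ground (EC2TD P) \<union> td_stream S) td_image \<subseteq> td_image"
proof
  fix a assume "a \<in> reduct_model (td_ground (EC2TD P) \<union> td_stream S) td_image"
  then show "a \<in> td_image"
  proof induction
    case (1 r)
    then have pos: "Pos b \<in> set (body r) \<Longrightarrow> b \<in> td_image" and
      neg: "Neg b \<in> set (body r) \<Longrightarrow> b \<notin> td_image" for b by blast+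
    from 1(1) consider "r \<in> ground_translation P" | "r \<in> td_stream S"
      unfolding td_ground_EC2TD by blast
    then show ?case
    proof cases
      case 2
      then obtain e xs s where r: "r = Rule (td_of (HappensAt e xs) s) []" "(e, xs, s) \<in> S"
        by (auto simp: td_stream_def facts_def)
      then have "Rule (At (HappensAt e xs) s) [] \<in> ec_stream S"
        by (auto simp: ec_stream_def facts_def)
      from rule_closed[OF UnI2, OF this] show ?thesis by (simp add: r del: td_of.simps add: td_of_in_image)
    next
      case 1
      then show ?thesis
      proof cases
        case (user r0 T \<sigma>)
        have "map_rule (ec_inst \<sigma> T) r0 \<in> ec_ground P" using user by (auto simp: ec_ground_def)
        moreover have "\<forall>b. Pos b \<in> set (body r) \<longrightarrow> b \<in> td_image"
          "\<forall>c. Neg c \<in> set (body r) \<longrightarrow> c \<notin> td_image" using pos neg by blast+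
        ultimately have "head (map_rule (ec_inst \<sigma> T) r0) \<in> M"
          by (intro rule_closed UnI1) ( auto simp: user(1) Pos_in_body_map_rule
              Neg_in_body_map_rule ec_inst_conv simp flip: td_of_in_image)
        then show ?thesis by (simp add: user(1) head_map_rule td_of_in_image ec_inst_conv)
      next
        case (holds_init f xs v T)
        have "At (HoldsAt f xs v) T \<in> M"
          by (rule domain_independent_closed[OF domain_independent.holds_init[OF holds_init(2,3)]])
            (use pos holds_init(1) in \<open>auto simp flip: td_of_in_image\<close>)
        then show ?thesis by (simp add: holds_init(1) td_of_in_image del: td_of.simps)
      next
        case (inertia f xs v T)
        have "At (HoldsAt f xs v) T \<in> M"
          by (rule domain_independent_closed[OF domain_independent.inertia[OF inertia(2,3)]])
            (use pos neg inertia(1) in \<open>auto simp flip: td_of_in_image\<close>)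
        then show ?thesis by (simp add: inertia(1) td_of_in_image del: td_of.simps)
      next
        case (other_value f xs v v' T)
        have "At (TerminatedAt f xs v) T \<in> M"
          by (rule domain_independent_closed[OF domain_independent.other_value[OF other_value(2-5)]])
            (use pos other_value(1) in \<open>auto simp flip: td_of_in_image\<close>)
        then show ?thesis by (simp add: other_value(1) td_of_in_image del: td_of.simps)
      next
        case (delayed f v v' d xs T)
        note g = ground_simple_fi[OF delayed(2,3)]
        \<comment> \<open>The translated rule is anchored at the effect, the original one at the
          initiation; \<open>T0\<close> is the time of the latter.\<close>
        define T0 where "T0 = T - int d"
        have T: "T = T0 + int d" by (simp add: T0_def)
        have init: "At (InitiatedAt f xs v) T0 \<in> M"
          using pos[of "td_of (InitiatedAt f xs v) T0"]
          by (simp add: delayed(1) T0_def td_of_in_image del: td_of.simps)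
        then have T0: "T0 \<ge> 1" by (rule time_pos)
        \<comment> \<open>Each instant strictly between \<open>T0\<close> and \<open>T\<close> is
          \<open>T - k\<close> with \<open>k = T - s\<close> in \<open>[1..<d]\<close>, so the
          finite list of negated conditions covers the whole open interval.\<close>
        have offset: "Neg (td_of a s) \<in> set (map (\<lambda>k. Neg (td_of a (T - int k))) (rev [1..<d]))"
          if "T0 < s" "s < T" for a s
          unfolding set_map by (rule image_eqI[of _ _ "nat (T - s)"]) (use that T in auto)
        have no_term: "At (TerminatedAt f xs v) s \<notin> M" if "T0 < s" "s < T" for s
        proof -
          have "Neg (td_of (TerminatedAt f xs v) s) \<in> set (body r)"
            unfolding delayed(1) rule.sel list.set set_append using offset[OF that] by blast
          from neg[OF this] show ?thesis by (simp add: td_of_in_image del: td_of.simps)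
        qed
        have no_init: "At (InitiatedAt f xs v) s \<notin> M" if "T0 < s" "s < T" "(f, v) \<in> ps P" for s
        proof -
          have "Neg (td_of (InitiatedAt f xs v) s) \<in> set (body r)"
            unfolding delayed(1) rule.sel list.set set_append if_P[OF that(3)]
            using offset[OF that(1,2)] by blast
          from neg[OF this] show ?thesis by (simp add: td_of_in_image del: td_of.simps)
        qed
        have "Cancelled f xs v T0 (T0 + int d) \<notin> M"
          using no_term no_init T by (auto simp: Cancelled_iff[OF g(1) T0 g(3)])
        then have "At (InitiatedAt f xs v') (T0 + int d) \<in> M"
          by (intro domain_independent_closed[OF domain_independent.delayed[OF g(1,2) T0 g(3)]])
            (auto simp: Fi_iff delayed init)
        then show ?thesis by (simp add: delayed(1) T td_of_in_image del: td_of.simps)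
      qed
    qed
  qed
qed

text \<open>Induction on derivations in the Event Calculus program, replaying each rule by its
  translation. Negated conditions are evaluated in \<open>M\<close> on one side and in its image on
  the other, where they agree.\<close>

lemma image_sub_reduct: "td_image \<subseteq> reduct_model (td_ground (EC2TD P) \<union> td_stream S) td_image"
proof -
  let ?R = "reduct_model (td_ground (EC2TD P) \<union> td_stream S) td_image"
  have tr: "head r \<in> ?R" if "r \<in> ground_translation P"
    "\<And>b. Pos b \<in> set (body r) \<Longrightarrow> b \<in> ?R" "\<And>c. Neg c \<in> set (body r) \<Longrightarrow> c \<notin> td_image" for r
    by (rule reduct_model.intros) (use that in \<open>auto simp: td_ground_EC2TD\<close>)
  \<comment> \<open>Auxiliary atoms have no image, so the claim is vacuous for them and the rules
    with such heads need no replay.\<close>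
  have "\<forall>b T. a = At b T \<longrightarrow> td_of b T \<in> ?R" if "a \<in> reduct_model (ec_ground P \<union> ec_stream S) M" for a
    using that
  proof induction
    case (1 r)
    then have pos: "Pos (At b T) \<in> set (body r) \<Longrightarrow> td_of b T \<in> ?R"
      and posM: "Pos a \<in> set (body r) \<Longrightarrow> a \<in> M"
      and neg: "Neg a \<in> set (body r) \<Longrightarrow> a \<notin> M" for a b T
      by (auto simp: stable)
    have "td_of b T \<in> ?R" if h: "head r = At b T" for b T
    proof -
      from 1(1) show ?thesis
      proof (cases rule: ec_ground_stream_cases)
        case (user r0 \<sigma> T')
        have "\<forall>b T. Pos (At b T) \<in> set (body r) \<longrightarrow> td_of b T \<in> ?R"
          "\<forall>a. Neg a \<in> set (body r) \<longrightarrow> a \<notin> M" using pos neg by blast+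
        then have "head (map_rule (\<lambda>a. td_of (ec_atom_inst \<sigma> a) T') r0) \<in> ?R"
          by (intro tr[OF ground_translation.user[OF user(1,2)]])
            (auto simp: user(3) Pos_in_body_map_rule Neg_in_body_map_rule
              td_of_in_image ec_inst_conv)
        then show ?thesis using h by (simp add: user(3) head_map_rule ec_inst_conv)
      next
        case (event e xs s)
        then have "Rule (td_of (HappensAt e xs) s) [] \<in> td_stream S"
          by (auto simp: td_stream_def facts_def)
        from reduct_model.intros[OF UnI2, OF this] event(2) h show ?thesis by auto
      next
        case domain_independent
        then show ?thesis
        proof cases
          case (delayed f xs v v' T0 d)
          \<comment> \<open>The induction hypothesis says nothing about \<open>Fi\<close>, but its
            truth in \<open>M\<close> shows that the program contains the fact, and hence that the
            translation contains the rule.\<close>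
          have fi: "(f, v, v', d) \<in> fis P" "length xs = fl_arity P f"
            using posM[of "Fi f xs v v' d"] by (simp_all add: delayed(1) Fi_iff)
          have "Cancelled f xs v T0 (T0 + int d) \<notin> M" using neg by (simp add: delayed(1))
          \<comment> \<open>For \<open>k\<close> in \<open>{1..<d}\<close> the instant
            \<open>T0 + d - k\<close> lies strictly between initiation and effect, where the absence
            of cancellation rules out these atoms.\<close>
          then have no: "At (TerminatedAt f xs v) (T0 + int d - int k) \<notin> M"
            "(f, v) \<in> ps P \<Longrightarrow> At (InitiatedAt f xs v) (T0 + int d - int k) \<notin> M" if "k \<in> {1..<d}" for k
            using that by (auto simp: Cancelled_iff[OF delayed(2,4,5)])
          have init: "td_of (InitiatedAt f xs v) T0 \<in> ?R" by (rule pos) (simp add: delayed(1))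
          have "T0 + int d \<ge> 1" using delayed(4) by simp
          then have "td_of (InitiatedAt f xs v') (T0 + int d) \<in> ?R"
            by (intro tr[OF ground_translation.delayed[OF fi], unfolded rule.sel])
              (use init no in \<open>auto simp: td_of_in_image simp del: td_of.simps split: if_splits\<close>)
          then show ?thesis using h by (auto simp: delayed(1) simp del: td_of.simps)
        next
          case (holds_init f xs v T')
          from tr[OF ground_translation.holds_init[OF holds_init(2,3)]] pos h show ?thesis
            by (auto simp: holds_init(1) simp del: td_of.simps)
        next
          case (inertia f xs v T')
          from tr[OF ground_translation.inertia[OF inertia(2,3)]] pos neg h show ?thesis
            by (auto simp: inertia(1) td_of_in_image simp del: td_of.simps)
        next
          case (other_value f xs v v' T')
          from tr[OF ground_translation.other_value[OF other_value(2-5)]] pos h show ?thesis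
            by (auto simp: other_value(1) simp del: td_of.simps)
        qed (use h in auto)
      qed (use h in auto)
    qed
    then show ?case by blast
  qed
  then show ?thesis by (auto simp: stable td_image_def)
qed

lemma td_image_stable: "reduct_model (td_ground (EC2TD P) \<union> td_stream S) td_image = td_image"
  using reduct_sub_image image_sub_reduct by (rule subset_antisym)

lemma perfect_model_translation:
  "perfect_model (td_ground (EC2TD P) \<union> td_stream S) = td_image"
proof -
  obtain rk where rk: "local_stratification (td_ground (EC2TD P) \<union> td_stream S) rk"
    by (rule translation_locally_stratified[OF program])
  from stable_unique[OF rk perfect_model_stable[OF rk] td_image_stable] show ?thesis .
qed

end

section \<open>Equivalence of the two semantics\<close>

theorem theorem2:
  fixes P :: "('e, 'f, 'o) ec_program" and S :: "('e, 'o) stream"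
  assumes "ec_de_program P" and "is_stream P S"
  shows "temporal_datalog (td_arity P) (EC2TD P) \<and>
    (\<forall>f xs v. ground_fluent P f xs v \<longrightarrow> (\<forall>t\<ge>1.
       At (HoldsAt f xs v) t \<in> perfect_model (ec_ground P \<union> ec_stream S) \<longleftrightarrow>
       TAtom (Holds f) (xs @ [v]) t \<in> perfect_model (td_ground (EC2TD P) \<union> td_stream S)))"
proof -
  obtain rk where "local_stratification (ec_ground P \<union> ec_stream S) rk"
    using ec_locally_stratified[OF assms(1)] by (auto simp: locally_stratified_def)
  \<comment> \<open>Stratification makes the perfect model stable, so it can play the role of
    \<open>M\<close>; its \<open>td_image\<close> is then the perfect model of the
    translation.\<close>
  then interpret ec_stable_model P S "perfect_model (ec_ground P \<union> ec_stream S)"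
    by unfold_locales (use assms perfect_model_stable in auto)
  have "At (HoldsAt f xs v) t \<in> perfect_model (ec_ground P \<union> ec_stream S) \<longleftrightarrow>
      TAtom (Holds f) (xs @ [v]) t \<in> perfect_model (td_ground (EC2TD P) \<union> td_stream S)" for f xs v t
    using td_of_in_image[of "HoldsAt f xs v" t] by (simp add: perfect_model_translation)
  with temporal_datalog_EC2TD[OF assms(1)] show ?thesis by blast
qed

end
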